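(* Let $S=\mathfrak v\oplus\mathfrak z\times\mathbb R_+$ be the half-space model of a Damek--Ricci space, let $\mathfrak v=\mathfrak v_+\oplus\mathfrak v_-$ be an orthogonal decomposition into $\mathrm{Cl}(\mathfrak z,q)$-submodules, $v_0\in\mathfrak v$, $z_0\in\mathfrak z$, $\lambda>0$, and let $F\colon S\to\mathbb R$ be the isoparametric function $$F(v,z,t)=\frac1t\left(\left(t+\left\|\tfrac{v-v_0}2\right\|^2\right)^2+\left\|z-z_0+\tfrac12[v,v_0]\right\|^2+\lambda\langle v-v_0,(\Pi_{\mathfrak v_+}-\Pi_{\mathfrak v_-})(v-v_0)\rangle+4\lambda^2\right),$$ where $\Pi_{\mathfrak v_\pm}$ are the orthogonal projections onto $\mathfrak v_\pm$. Let $S_-=\mathfrak v_-\oplus\mathfrak z\times\mathbb R_+\subseteq S$ be the Lie subgroup of $S$ corresponding to the Lie subalgebra $\mathfrak v_-\oplus\mathfrak z\oplus\mathfrak a$ of the Lie algebra of $S$. Then $S_-$ is also a Damek--Ricci space isometrically embedded into $S$. Set $v_0'=\Pi_{\mathfrak v_-}(v_0)$ and $v_0''=\Pi_{\mathfrak v_+}(v_0)$, and let $\mathcal F_{(v_0',z_0,-2\lambda)}\subset S_-$ be the focal variety of the isoparametric function $$F_{(v_0',z_0,-2\lambda)}(v,z,t)=\frac1t\left(\left(t-2\lambda+\left\|\tfrac{v-v_0'}2\right\|^2\right)^2+\left\|z-z_0+\tfrac12[v,v_0']\right\|^2\right)$$ on $S_-$. Then the focal variety $\mathcal F$ of $F$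 is the left translate of $\mathcal F_{(v_0',z_0,-2\lambda)}$ by $(v_0'',0,1)$, i.e. $\mathcal F=L_{(v_0'',0,1)}\left(\mathcal F_{(v_0',z_0,-2\lambda)}\right)$.
   Context: Damek--Ricci data: $\mathfrak v,\mathfrak z$ are finite-dimensional real Euclidean vector spaces, and $J\colon\mathfrak z\to\mathrm{End}(\mathfrak v)$, $z\mapsto J_z$, is the linear map underlying a representation on $\mathfrak v$ of the Clifford algebra $\mathrm{Cl}(\mathfrak z,q)$, $q(z)=-\langle z,z\rangle$ (so $J_z^2=-\|z\|^2\mathrm{Id}$), such that $\|J_zv\|=\|z\|\|v\|$ for all $z,v$. A $\mathrm{Cl}(\mathfrak z,q)$-submodule of $\mathfrak v$ is a linear subspace invariant under all $J_z$. The skew-symmetric bilinear map $[\cdot,\cdot]\colon\mathfrak v\times\mathfrak v\to\mathfrak z$ is defined by $\langle[v_1,v_2],z\rangle=\langle J_zv_1,v_2\rangle$ for all $z\in\mathfrak z$. The half-space model of the Damek--Ricci space is $S=\mathfrak v\oplus\mathfrak z\times\mathbb R_+=\{(v,z,t): t>0\}$ with the group multiplication $$(v_1,z_1,t_1)\cdot(v_2,z_2,t_2)=\left(v_1+\sqrt{t_1}\,v_2,\ z_1+t_1z_2+\tfrac12\sqrt{t_1}[v_1,v_2],\ t_1t_2\right)$$ and the left-invariant Riemannian metric $$\langle(v_1,z_1,t_1),(v_2,z_2,t_2)\rangle_{(\bar v,\bar z,\bar t)}=\tfrac1{\bar t}\langle v_1,v_2\rangle+\tfrac1{\bar t^2}\left\langle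 z_1+\tfrac12[v_1,\bar v],z_2+\tfrac12[v_2,\bar v]\right\rangle+\tfrac{t_1t_2}{\bar t^2}.$$ Its Lie algebra is identified with $\mathfrak v\oplus\mathfrak z\oplus\mathfrak a$, where $\mathfrak a\cong\mathbb R$ corresponds to the $t$-direction at the identity $(0,0,1)$. $L_g$ denotes left translation by $g\in S$. The Damek--Ricci structure on $S_-$ is the one built from $\mathfrak v_-$, $\mathfrak z$ and the restriction $J_z|_{\mathfrak v_-}$. A smooth function $F\colon M\to\mathbb R$ on a Riemannian manifold is isoparametric if $\Delta F=a\circ F$ and $\|\nabla F\|^2=b\circ F$ for a continuous $a$ and a $\mathcal C^2$ function $b$ on $\mathrm{im}\,F$. The focal varieties of an isoparametric function are its singular level sets, i.e. the level sets of its singular (critical) values. For the two functions in the claim, there is exactly one focal variety, the set where the function attains its minimum. *)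

theory Defs
  imports "HOL-Analysis.Analysis" "HOL-Algebra.Group"
begin

section \<open>Damek--Ricci data\<close>

text \<open>
  The Euclidean spaces are carried by linear subspaces \<open>V\<close> and \<open>Z\<close> of ambient Euclidean
  types. This keeps the zero-dimensional cases (a Euclidean type has positive dimension), and it
  lets a Clifford submodule of \<open>V\<close> be the first component of Damek--Ricci data again.

  By the universal property of \<open>Cl(Z,q)\<close>, \<open>q(z) = - \<langle>z,z\<rangle>\<close>, the linear maps
  \<open>J : Z \<rightarrow> End(V)\<close> underlying a representation of \<open>Cl(Z,q)\<close> on \<open>V\<close> are
  exactly those with \<open>J\<^sub>z\<^sup>2 = q(z) Id\<close>. Values of \<open>J\<close> off the carriers are irrelevant.
\<close>

locale damek_ricci =
  fixes V :: "'v::euclidean_space set"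
    and Z :: "'z::euclidean_space set"
    and J :: "'z \<Rightarrow> 'v \<Rightarrow> 'v"
  assumes subspace_V: "subspace V"
    and subspace_Z: "subspace Z"
    and J_closed: "\<lbrakk>z \<in> Z; v \<in> V\<rbrakk> \<Longrightarrow> J z v \<in> V"
    and J_add_right: "\<lbrakk>z \<in> Z; v \<in> V; w \<in> V\<rbrakk> \<Longrightarrow> J z (v + w) = J z v + J z w"
    and J_scale_right: "\<lbrakk>z \<in> Z; v \<in> V\<rbrakk> \<Longrightarrow> J z (c *\<^sub>R v) = c *\<^sub>R J z v"
    and J_add_left: "\<lbrakk>y \<in> Z; z \<in> Z; v \<in> V\<rbrakk> \<Longrightarrow> J (y + z) v = J y v + J z v"
    and J_scale_left: "\<lbrakk>z \<in> Z; v \<in> V\<rbrakk> \<Longrightarrow> J (c *\<^sub>R z) v = c *\<^sub>R J z v"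
    and J_Clifford: "\<lbrakk>z \<in> Z; v \<in> V\<rbrakk> \<Longrightarrow> J z (J z v) = - ((norm z)\<^sup>2) *\<^sub>R v"
    and J_norm: "\<lbrakk>z \<in> Z; v \<in> V\<rbrakk> \<Longrightarrow> norm (J z v) = norm z * norm v"

definition clifford_submodule ::
    "'v::euclidean_space set \<Rightarrow> 'z::euclidean_space set \<Rightarrow> ('z \<Rightarrow> 'v \<Rightarrow> 'v) \<Rightarrow> 'v set \<Rightarrow> bool"
  where "clifford_submodule V Z J W \<longleftrightarrow>
    subspace W \<and> W \<subseteq> V \<and> (\<forall>z\<in>Z. \<forall>w\<in>W. J z w \<in> W)"

definition J_restrict :: "('z \<Rightarrow> 'v \<Rightarrow> 'v) \<Rightarrow> 'v set \<Rightarrow> 'z \<Rightarrow> 'v \<Rightarrow> 'v"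
  where "J_restrict J W = (\<lambda>z. restrict (J z) W)"

definition orthogonal_direct_sum :: "'v::euclidean_space set \<Rightarrow> 'v set \<Rightarrow> 'v set \<Rightarrow> bool"
  where "orthogonal_direct_sum V A B \<longleftrightarrow>
    V = {a + b | a b. a \<in> A \<and> b \<in> B} \<and> (\<forall>a\<in>A. \<forall>b\<in>B. orthogonal a b)"

definition orth_proj :: "'v::euclidean_space set \<Rightarrow> 'v \<Rightarrow> 'v"
  where "orth_proj W v = (THE w. w \<in> W \<and> (\<forall>u\<in>W. orthogonal (v - w) u))"

definition dr_bracket ::
    "'z::euclidean_space set \<Rightarrow> ('z \<Rightarrow> 'v::euclidean_space \<Rightarrow> 'v) \<Rightarrow> 'v \<Rightarrow> 'v \<Rightarrow> 'z"
  where "dr_bracket Z J v w = (THE y. y \<in> Z \<and> (\<forall>z\<in>Z. y \<bullet> z = J z v \<bullet> w))"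


section \<open>The half-space model\<close>

definition dr_space ::
    "'v::euclidean_space set \<Rightarrow> 'z::euclidean_space set \<Rightarrow> ('v \<times> 'z \<times> real) set"
  where "dr_space V Z = V \<times> Z \<times> {0<..}"

text \<open>The tangent space at every point of \<open>dr_space V Z\<close>, and the underlying vector space
  \<open>\<vv> \<oplus> \<zz> \<oplus> \<aa>\<close> of the Lie algebra.\<close>

definition dr_tangent ::
    "'v::euclidean_space set \<Rightarrow> 'z::euclidean_space set \<Rightarrow> ('v \<times> 'z \<times> real) set"
  where "dr_tangent V Z = V \<times> Z \<times> UNIV"

fun dr_mult ::
    "'z::euclidean_space set \<Rightarrow> ('z \<Rightarrow> 'v::euclidean_space \<Rightarrow> 'v) \<Rightarrow>
     'v \<times> 'z \<times> real \<Rightarrow> 'v \<times> 'z \<times> real \<Rightarrow> 'v \<times> 'z \<times> real"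
  where "dr_mult Z J (v1, z1, t1) (v2, z2, t2) =
    (v1 + sqrt t1 *\<^sub>R v2,
     z1 + t1 *\<^sub>R z2 + (1/2 * sqrt t1) *\<^sub>R dr_bracket Z J v1 v2,
     t1 * t2)"

definition dr_group ::
    "'v::euclidean_space set \<Rightarrow> 'z::euclidean_space set \<Rightarrow> ('z \<Rightarrow> 'v \<Rightarrow> 'v) \<Rightarrow>
     ('v \<times> 'z \<times> real) monoid"
  where "dr_group V Z J = \<lparr>carrier = dr_space V Z, mult = dr_mult Z J, one = (0, 0, 1)\<rparr>"

text \<open>\<open>dr_metric Z J p X Y\<close> is the inner product of the tangent vectors \<open>X\<close>, \<open>Y\<close> at \<open>p\<close>.\<close>

fun dr_metric ::
    "'z::euclidean_space set \<Rightarrow> ('z \<Rightarrow> 'v::euclidean_space \<Rightarrow> 'v) \<Rightarrow>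
     'v \<times> 'z \<times> real \<Rightarrow> 'v \<times> 'z \<times> real \<Rightarrow> 'v \<times> 'z \<times> real \<Rightarrow> real"
  where "dr_metric Z J (v, z, t) (v1, z1, t1) (v2, z2, t2) =
    1 / t * (v1 \<bullet> v2)
    + 1 / t\<^sup>2 * ((z1 + (1/2) *\<^sub>R dr_bracket Z J v1 v) \<bullet> (z2 + (1/2) *\<^sub>R dr_bracket Z J v2 v))
    + t1 * t2 / t\<^sup>2"


section \<open>Lie subgroups\<close>

text \<open>
  In this section \<open>G\<close> is a Lie group whose carrier is a relatively open subset of a linear
  subspace of a normed vector space, so that its tangent vectors are elements of that subspace. The Lie algebra of a closed subgroup \<open>H\<close> consists of the initial velocities of
  the one-parameter subgroups that lie in \<open>H\<close>.
\<close>

definition lie_algebra_of :: "('a::real_normed_vector, 'b) monoid_scheme \<Rightarrow> 'a set \<Rightarrow> 'a set"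
  where "lie_algebra_of G H =
    {X. \<exists>\<gamma> :: real \<Rightarrow> 'a. (\<forall>r. \<gamma> r \<in> H) \<and> (\<forall>r s. \<gamma> (r + s) = \<gamma> r \<otimes>\<^bsub>G\<^esub> \<gamma> s) \<and>
      (\<gamma> has_vector_derivative X) (at 0)}"

text \<open>The value at \<open>p\<close> of the left-invariant vector field extending \<open>X\<close>.\<close>

definition left_invariant_field ::
    "('a::real_normed_vector, 'b) monoid_scheme \<Rightarrow> 'a \<Rightarrow> 'a \<Rightarrow> 'a"
  where "left_invariant_field G X p =
    vector_derivative (\<lambda>r. p \<otimes>\<^bsub>G\<^esub> (\<one>\<^bsub>G\<^esub> + r *\<^sub>R X)) (at 0)"

text \<open>The commutator \<open>D\<^sub>X Y - D\<^sub>Y X\<close> of the left-invariant vector fields, at the identity.\<close>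

definition lie_bracket :: "('a::real_normed_vector, 'b) monoid_scheme \<Rightarrow> 'a \<Rightarrow> 'a \<Rightarrow> 'a"
  where "lie_bracket G X Y =
    vector_derivative (\<lambda>r. left_invariant_field G Y (\<one>\<^bsub>G\<^esub> + r *\<^sub>R X)) (at 0)
    - vector_derivative (\<lambda>r. left_invariant_field G X (\<one>\<^bsub>G\<^esub> + r *\<^sub>R Y)) (at 0)"

definition lie_subalgebra :: "('a::real_normed_vector, 'b) monoid_scheme \<Rightarrow> 'a set \<Rightarrow> bool"
  where "lie_subalgebra G A \<longleftrightarrow>
    subspace A \<and> A \<subseteq> lie_algebra_of G (carrier G) \<and> (\<forall>X\<in>A. \<forall>Y\<in>A. lie_bracket G X Y \<in> A)"

text \<open>\<open>H\<close> is the connected Lie subgroup with Lie algebra \<open>A\<close>, and moreover it is closed.\<close>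

definition closed_lie_subgroup_with_algebra ::
    "('a::real_normed_vector, 'b) monoid_scheme \<Rightarrow> 'a set \<Rightarrow> 'a set \<Rightarrow> bool"
  where "closed_lie_subgroup_with_algebra G H A \<longleftrightarrow>
    group G \<and> subgroup H G \<and> closedin (top_of_set (carrier G)) H \<and> connected H \<and>
    lie_subalgebra G A \<and> lie_algebra_of G H = A"


section \<open>Isometric embeddings and focal varieties\<close>

text \<open>
  The sets \<open>M\<close> below are relatively open in a linear subspace \<open>T\<close>, which serves
  as tangent space at every point. A derivative within \<open>M\<close> is then determined on \<open>T\<close> and
  arbitrary in the directions transverse to \<open>T\<close>.
\<close>

primrec C_k_on ::
    "nat \<Rightarrow> 'a::real_normed_vector set \<Rightarrow> ('a \<Rightarrow> 'b::real_normed_vector) \<Rightarrow> bool"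
  where
    "C_k_on 0 M f \<longleftrightarrow> continuous_on M f"
  | "C_k_on (Suc k) M f \<longleftrightarrow>
      (\<exists>f'. (\<forall>p\<in>M. (f has_derivative f' p) (at p within M)) \<and> (\<forall>X. C_k_on k M (\<lambda>p. f' p X)))"

definition smooth_map_on ::
    "'a::real_normed_vector set \<Rightarrow> ('a \<Rightarrow> 'b::real_normed_vector) \<Rightarrow> bool"
  where "smooth_map_on M f \<longleftrightarrow> (\<forall>k. C_k_on k M f)"

text \<open>\<open>\<phi>\<close> is a smooth topological embedding of \<open>M\<close> (tangent space \<open>T\<close>, metric \<open>g\<close>) into \<open>N\<close>
  (metric \<open>h\<close>) with \<open>\<phi>\<^sup>* h = g\<close>; it is an immersion because \<open>g\<close> is positive definite on \<open>T\<close>.\<close>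

definition isometric_embedding ::
    "'a::real_normed_vector set \<Rightarrow> 'a set \<Rightarrow> ('a \<Rightarrow> 'a \<Rightarrow> 'a \<Rightarrow> real) \<Rightarrow>
     'b::real_normed_vector set \<Rightarrow> ('b \<Rightarrow> 'b \<Rightarrow> 'b \<Rightarrow> real) \<Rightarrow> ('a \<Rightarrow> 'b) \<Rightarrow> bool"
  where "isometric_embedding M T g N h \<phi> \<longleftrightarrow>
    \<phi> ` M \<subseteq> N \<and> smooth_map_on M \<phi> \<and> (\<exists>\<psi>. homeomorphism M (\<phi> ` M) \<phi> \<psi>) \<and>
    (\<forall>p\<in>M. \<exists>D. (\<phi> has_derivative D) (at p within M) \<and>
      (\<forall>X\<in>T. \<forall>Y\<in>T. h (\<phi> p) (D X) (D Y) = g p X Y))"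

text \<open>The zero map is a derivative within \<open>M\<close> exactly if the intrinsic differential vanishes.\<close>

definition critical_point :: "'a::real_normed_vector set \<Rightarrow> ('a \<Rightarrow> real) \<Rightarrow> 'a \<Rightarrow> bool"
  where "critical_point M F p \<longleftrightarrow> p \<in> M \<and> (F has_derivative (\<lambda>_. 0)) (at p within M)"

definition focal_varieties :: "'a::real_normed_vector set \<Rightarrow> ('a \<Rightarrow> real) \<Rightarrow> 'a set set"
  where "focal_varieties M F = {{q \<in> M. F q = c} | c. \<exists>p. critical_point M F p \<and> F p = c}"


section \<open>The two functions\<close>

text \<open>The function \<open>F\<^bsub>(v0,z0,t0)\<^esub>\<close>, for any real \<open>t0\<close>.\<close>

fun dr_F_point ::
    "'z::euclidean_space set \<Rightarrow> ('z \<Rightarrow> 'v::euclidean_space \<Rightarrow> 'v) \<Rightarrow> 'v \<times> 'z \<times> real \<Rightarrow>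
     'v \<times> 'z \<times> real \<Rightarrow> real"
  where "dr_F_point Z J (v0, z0, t0) (v, z, t) =
    1 / t * ((t + t0 + (norm ((v - v0) /\<^sub>R 2))\<^sup>2)\<^sup>2
             + (norm (z - z0 + (1/2) *\<^sub>R dr_bracket Z J v v0))\<^sup>2)"

fun dr_F_decomp ::
    "'z::euclidean_space set \<Rightarrow> ('z \<Rightarrow> 'v::euclidean_space \<Rightarrow> 'v) \<Rightarrow> 'v set \<Rightarrow> 'v set \<Rightarrow>
     'v \<Rightarrow> 'z \<Rightarrow> real \<Rightarrow> 'v \<times> 'z \<times> real \<Rightarrow> real"
  where "dr_F_decomp Z J Vp Vm v0 z0 l (v, z, t) =
    1 / t * ((t + (norm ((v - v0) /\<^sub>R 2))\<^sup>2)\<^sup>2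
             + (norm (z - z0 + (1/2) *\<^sub>R dr_bracket Z J v v0))\<^sup>2
             + l * ((v - v0) \<bullet> (orth_proj Vp (v - v0) - orth_proj Vm (v - v0)))
             + 4 * l\<^sup>2)"

end

theory Submission
  imports Defs
begin

text \<open>
  Put \<open>a = v - v\<^sub>0\<close>, \<open>A = t + \<parallel>a\<parallel>\<^sup>2 / 4\<close>, \<open>p = \<Pi>\<^sub>+ a\<close> and \<open>\<zeta> = z - z\<^sub>0 + [v,v\<^sub>0] / 2\<close>.
  Completing the square gives
  \<open>t F = 4\<lambda>t + (A - 2\<lambda>)\<^sup>2 + 2\<lambda>\<parallel>p\<parallel>\<^sup>2 + \<parallel>\<zeta>\<parallel>\<^sup>2\<close>,
  so \<open>F \<ge> 4\<lambda>\<close>, with equality exactly where \<open>A = 2\<lambda>\<close>, \<open>p = 0\<close>, \<open>\<zeta> = 0\<close>. At a critical point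
  the derivatives along \<open>(0, \<zeta>, 0)\<close>, \<open>(p, 0, 0)\<close> and along a dilation force \<open>\<zeta> = 0\<close>,
  \<open>p = 0\<close> and \<open>A = 2\<lambda>\<close> in turn, so the set of minima is the only focal variety. The function on
  \<open>S\<^sub>-\<close> has the same form with \<open>p = 0\<close> and without the constant \<open>4\<lambda>\<close>. Finally \<open>p = 0\<close> says
  \<open>v \<in> \<Pi>\<^sub>+ v\<^sub>0 + \<vv>\<^sub>-\<close>, and \<open>[\<vv>\<^sub>+, \<vv>\<^sub>-] = 0\<close> makes the left translation by
  \<open>(\<Pi>\<^sub>+ v\<^sub>0, 0, 1)\<close> a mere shift of the first component on \<open>S\<^sub>-\<close>.
\<close>

section \<open>Derivatives\<close>

lemma has_vector_derivative_scaleR_const: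
  "(g has_real_derivative D) (at x) \<Longrightarrow> ((\<lambda>r. g r *\<^sub>R u) has_vector_derivative D *\<^sub>R u) (at x)"
  using has_vector_derivative_scaleR[OF _ has_vector_derivative_const[of u]] by fastforce

lemma C_k_on_const: "C_k_on k M (\<lambda>_. c)"
proof (induction k arbitrary: c)
  case (Suc k)
  then show ?case
    by (auto intro!: exI[of _ "\<lambda>_ _. 0"] has_derivative_const)
qed simp

lemma C_k_on_id: "C_k_on k M (\<lambda>p. p)"
proof (cases k)
  case (Suc k')
  then show ?thesis
    by (auto intro!: exI[of _ "\<lambda>_ X. X"] C_k_on_const)
qed simp

text \<open>The differential of a squared norm is \<open>2 * (f x \<bullet> f' h)\<close>, which
  dies with \<open>f x\<close>. At the candidate focal points every summand of the numerator of
  \<open>F\<close> is of this kind.\<close>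

lemma has_derivative_norm_power2_zero:
  fixes f :: "'a::real_normed_vector \<Rightarrow> 'b::real_inner"
  assumes "(f has_derivative f') (at x within S)" "f x = 0"
  shows "((\<lambda>y. (norm (f y))\<^sup>2) has_derivative (\<lambda>_. 0)) (at x within S)"
  using has_derivative_inner[OF assms(1) assms(1)] assms(2) by (simp add: power2_norm_eq_inner)


section \<open>Orthogonal projections\<close>

lemma orth_projI:
  assumes W: "subspace W" and w: "w \<in> W" "\<And>u. u \<in> W \<Longrightarrow> (v - w) \<bullet> u = 0"
  shows "orth_proj W v = w"
  unfolding orth_proj_def orthogonal_def
proof (rule the_equality)
  fix w' assume w': "w' \<in> W \<and> (\<forall>u\<in>W. (v - w') \<bullet> u = 0)"
  have "w' - w \<in> W"
    using W w w' by (simp add: subspace_diff)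
  \<comment> \<open>Both candidates are tested against their own difference, which lies in
    \<open>W\<close>; subtracting shows that it is orthogonal to itself.\<close>
  then have "(v - w) \<bullet> (w' - w) = 0" "(v - w') \<bullet> (w' - w) = 0"
    using w w' by auto
  then have "(w' - w) \<bullet> (w' - w) = 0"
    by (simp add: inner_diff_left)
  then show "w' = w" by simp
qed (use w in auto)

lemma orth_proj:
  assumes W: "subspace W"
  shows orth_proj_in: "orth_proj W v \<in> W"
    and inner_diff_orth_proj: "u \<in> W \<Longrightarrow> (v - orth_proj W v) \<bullet> u = 0"
proof -
  obtain y z where yz: "y \<in> span W" "\<And>w. w \<in> span W \<Longrightarrow> orthogonal z w" "v = y + z"
    using orthogonal_subspace_decomp_exists by blast
  have "span W = W" using W by (simp add: span_eq_iff)
  with yz have *: "y \<in> W" "\<And>w. w \<in> W \<Longrightarrow> (v - y) \<bullet> w = 0"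
    by (auto simp: orthogonal_def)
  have "orth_proj W v = y"
    by (rule orth_projI) (use W * in auto)
  then show "orth_proj W v \<in> W" "u \<in> W \<Longrightarrow> (v - orth_proj W v) \<bullet> u = 0"
    using * by auto
qed

lemma inner_orth_proj:
  "subspace W \<Longrightarrow> u \<in> W \<Longrightarrow> orth_proj W v \<bullet> u = v \<bullet> u"
  using inner_diff_orth_proj[of W u v] by (simp add: inner_diff_left)

lemma orth_proj_ident: "subspace W \<Longrightarrow> w \<in> W \<Longrightarrow> orth_proj W w = w"
  by (rule orth_projI) auto

lemma linear_orth_proj:
  assumes W: "subspace W" shows "linear (orth_proj W)"
proof
  show "orth_proj W (x + y) = orth_proj W x + orth_proj W y" for x y
    by (rule orth_projI)
      (use W in \<open>auto simp: subspace_add orth_proj_in inner_diff_left inner_add_left inner_orth_proj\<close>)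
  show "orth_proj W (c *\<^sub>R x) = c *\<^sub>R orth_proj W x" for c x
    by (rule orth_projI)
      (use W in \<open>auto simp: subspace_scale orth_proj_in inner_diff_left inner_orth_proj\<close>)
qed

lemma orth_proj_direct_sum:
  assumes "subspace A" "subspace B" "orthogonal_direct_sum V A B" "v \<in> V"
  shows "v = orth_proj A v + orth_proj B v"
proof -
  obtain a b where ab: "v = a + b" "a \<in> A" "b \<in> B"
    using assms unfolding orthogonal_direct_sum_def by blast
  have o: "x \<bullet> y = 0" "y \<bullet> x = 0" if "x \<in> A" "y \<in> B" for x y
    using assms that by (auto simp: orthogonal_direct_sum_def orthogonal_def inner_commute)
  have "orth_proj A v = a" "orth_proj B v = b"
    by (rule orth_projI; use assms ab o in auto)+
  then show ?thesis using ab by simp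
qed


section \<open>The bracket\<close>

lemma clifford_submoduleD:
  assumes "clifford_submodule V Z J W"
  shows "subspace W" "W \<subseteq> V" "\<And>z w. z \<in> Z \<Longrightarrow> w \<in> W \<Longrightarrow> J z w \<in> W"
  using assms by (auto simp: clifford_submodule_def)

text \<open>The bracket applies \<open>J z\<close> to its first argument only. As a simp rule this
  transfers group law, metric and focal function between the restricted and the full
  structure.\<close>

lemma dr_bracket_restrict [simp]:
  "v \<in> W \<Longrightarrow> dr_bracket Z (J_restrict J W) v w = dr_bracket Z J v w"
  by (simp add: dr_bracket_def J_restrict_def)

context damek_ricci
begin

abbreviation br :: "'v \<Rightarrow> 'v \<Rightarrow> 'z"
  where "br \<equiv> dr_bracket Z J"

lemma br_eqI:
  assumes y: "y \<in> Z" "\<And>z. z \<in> Z \<Longrightarrow> y \<bullet> z = J z v \<bullet> w"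
  shows "br v w = y"
  unfolding dr_bracket_def
proof (rule the_equality)
  fix y' assume y': "y' \<in> Z \<and> (\<forall>z\<in>Z. y' \<bullet> z = J z v \<bullet> w)"
  have "y' - y \<in> Z" using subspace_Z y y' by (simp add: subspace_diff)
  then have "(y' - y) \<bullet> (y' - y) = 0"
    using y y' by (simp add: inner_diff_left)
  then show "y' = y" by simp
qed (use y in auto)

text \<open>Riesz representation. Precomposing with the projection onto \<open>Z\<close> turns the
  functional into a linear map on the whole ambient type; its adjoint at \<open>1\<close> represents
  it there, and projecting that vector back to \<open>Z\<close> preserves the inner products with
  \<open>Z\<close>.\<close>

lemma assumes "v \<in> V"
  shows br_in: "br v w \<in> Z"
    and inner_br: "z \<in> Z \<Longrightarrow> br v w \<bullet> z = J z v \<bullet> w"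
proof -
  let ?P = "orth_proj Z"
  let ?f = "\<lambda>z. J (?P z) v \<bullet> w"
  note P = orth_proj_in[OF subspace_Z] linear_orth_proj[OF subspace_Z]
  have "linear ?f"
    by (rule linearI)
      (use P assms in \<open>simp_all add: linear_add linear_cmul J_add_left J_scale_left inner_add_left\<close>)
  then have f: "adjoint ?f 1 \<bullet> z = ?f z" for z
    using adjoint_works[of ?f z 1] by (simp add: inner_commute)
  define y where "y = ?P (adjoint ?f 1)"
  have y: "y \<in> Z" "z \<in> Z \<Longrightarrow> y \<bullet> z = J z v \<bullet> w" for z
    by (simp_all add: y_def P inner_orth_proj[OF subspace_Z] f orth_proj_ident[OF subspace_Z])
  have "br v w = y"
    by (rule br_eqI) (use y in auto)
  then show "br v w \<in> Z" "z \<in> Z \<Longrightarrow> br v w \<bullet> z = J z v \<bullet> w"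
    using y by auto
qed

lemma br_add_left: "v \<in> V \<Longrightarrow> v' \<in> V \<Longrightarrow> br (v + v') w = br v w + br v' w"
  by (rule br_eqI)
    (auto simp: br_in subspace_Z subspace_add inner_add_left inner_br J_add_right)

lemma br_add_right: "v \<in> V \<Longrightarrow> br v (w + w') = br v w + br v w'"
  by (rule br_eqI)
    (auto simp: br_in subspace_Z subspace_add inner_add_left inner_add_right inner_br)

lemma br_scale_left: "v \<in> V \<Longrightarrow> br (c *\<^sub>R v) w = c *\<^sub>R br v w"
  by (rule br_eqI) (auto simp: br_in subspace_Z subspace_scale inner_br J_scale_right)

lemma br_scale_right: "v \<in> V \<Longrightarrow> br v (c *\<^sub>R w) = c *\<^sub>R br v w"
  by (rule br_eqI) (auto simp: br_in subspace_Z subspace_scale inner_br)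

text \<open>Polarizing \<open>J_norm\<close> shows that \<open>J z\<close> scales inner products by
  \<open>(norm z)\<^sup>2\<close>. Replacing one argument by its image under \<open>J z\<close> and
  applying \<open>J_Clifford\<close> gives skewness up to this factor, which is cancelled when
  \<open>z\<close> is nonzero.\<close>

lemma J_skew:
  assumes z: "z \<in> Z" and v: "v \<in> V" "w \<in> V"
  shows "J z v \<bullet> w = - (v \<bullet> J z w)"
proof (cases "z = 0")
  case True
  have "J 0 u = 0" if "u \<in> V" for u
    using J_scale_left[of 0 u 0] that subspace_Z by (simp add: subspace_0)
  with True v show ?thesis by simp
next
  case False
  have polar: "J z x \<bullet> J z y = (norm z)\<^sup>2 * (x \<bullet> y)" if "x \<in> V" "y \<in> V" for x y
  proof -
    have "(norm (J z (x + y)))\<^sup>2 = (norm z)\<^sup>2 * (norm (x + y))\<^sup>2"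
      using z that subspace_V by (simp add: J_norm subspace_add power_mult_distrib)
    moreover have "(norm (J z x))\<^sup>2 = (norm z)\<^sup>2 * (norm x)\<^sup>2" "(norm (J z y))\<^sup>2 = (norm z)\<^sup>2 * (norm y)\<^sup>2"
      using z that by (simp_all add: J_norm power_mult_distrib)
    ultimately show ?thesis
      using z that
      by (simp add: J_add_right power2_norm_eq_inner inner_add_left inner_add_right
          inner_commute algebra_simps)
  qed
  have "J z v \<bullet> (- ((norm z)\<^sup>2) *\<^sub>R w) = (norm z)\<^sup>2 * (v \<bullet> J z w)"
    using polar[of v "J z w"] z v by (simp add: J_closed J_Clifford)
  then have "(norm z)\<^sup>2 * (J z v \<bullet> w + v \<bullet> J z w) = 0"
    by (simp add: distrib_left)
  with False show ?thesis by (simp add: eq_neg_iff_add_eq_0)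
qed

lemma br_self: assumes "v \<in> V" shows "br v v = 0"
proof (rule br_eqI)
  show "0 \<bullet> z = J z v \<bullet> v" if "z \<in> Z" for z
    using J_skew[OF that assms assms] by (simp add: inner_commute)
qed (simp add: subspace_Z subspace_0)

text \<open>\<open>J z v\<close> stays in \<open>A\<close>, so it pairs to zero with
  \<open>w\<close>. Applied to both summands of the decomposition, this makes them commute.\<close>

lemma br_submodule_orthogonal:
  assumes A: "clifford_submodule V Z J A" and v: "v \<in> A" and w: "\<And>a. a \<in> A \<Longrightarrow> a \<bullet> w = 0"
  shows "br v w = 0"
  by (rule br_eqI) (use clifford_submoduleD[OF A] v w in \<open>auto simp: subspace_Z subspace_0\<close>)

text \<open>The bracket is controlled only for first arguments in \<open>V\<close>. Inserting the
  projection gives a globally linear map that agrees with it on \<open>V\<close>, so it can be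
  differentiated as its own derivative.\<close>

lemma linear_br_left: "linear (\<lambda>v. br (orth_proj V v) w)"
  by (rule linearI)
    (simp_all add: linear_orth_proj[OF subspace_V] linear_add linear_cmul
      br_add_left br_scale_left orth_proj_in[OF subspace_V])

text \<open>This lets the results on subgroups speak about the full group too, in particular about
  its Lie algebra.\<close>

lemma clifford_submodule_self: "clifford_submodule V Z J V"
  by (simp add: clifford_submodule_def subspace_V J_closed)

lemma damek_ricci_submodule:
  assumes W: "clifford_submodule V Z J W"
  shows "damek_ricci W Z (J_restrict J W)"
proof -
  note W' = clifford_submoduleD[OF W]
  show ?thesis
    by unfold_locales
      (use W' in \<open>auto simp: J_restrict_def subset_iff subspace_Z subspace_add subspace_scale
        J_add_right J_scale_right J_add_left J_scale_left J_Clifford J_norm\<close>)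
qed


section \<open>The group, its Lie subgroups and their embeddings\<close>

lemma dr_left_inverse:
  assumes "v \<in> V" "z \<in> Z" "t > 0"
  defines "y \<equiv> ((- inverse (sqrt t)) *\<^sub>R v, (- inverse t) *\<^sub>R z, inverse t)"
  shows "y \<in> dr_space V Z" "dr_mult Z J y (v, z, t) = (0, 0, 1)"
proof -
  show "y \<in> dr_space V Z"
    using assms unfolding dr_space_def y_def
    by (simp add: subspace_V subspace_Z subspace_scale subspace_neg)
  \<comment> \<open>The first component of the inverse is a multiple of \<open>v\<close>, so no
    bracket correction appears in its second component.\<close>
  have "br ((- inverse (sqrt t)) *\<^sub>R v) v = 0"
    using assms br_scale_left[of v "- inverse (sqrt t)" v] by (simp add: br_self)
  then show "dr_mult Z J y (v, z, t) = (0, 0, 1)"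
    using assms by (simp add: y_def real_sqrt_inverse)
qed

lemma group_dr: "group (dr_group V Z J)"
proof (rule groupI)
  show "x \<otimes>\<^bsub>dr_group V Z J\<^esub> y \<in> carrier (dr_group V Z J)"
    if "x \<in> carrier (dr_group V Z J)" "y \<in> carrier (dr_group V Z J)" for x y
    using that
    by (auto simp: dr_group_def dr_space_def subspace_V subspace_Z subspace_add subspace_scale br_in)
  show "\<one>\<^bsub>dr_group V Z J\<^esub> \<in> carrier (dr_group V Z J)"
    by (simp add: dr_group_def dr_space_def subspace_V subspace_Z subspace_0)
  show "\<one>\<^bsub>dr_group V Z J\<^esub> \<otimes>\<^bsub>dr_group V Z J\<^esub> x = x" if "x \<in> carrier (dr_group V Z J)" for x
    using that br_scale_left[of 0 0]
    by (auto simp: dr_group_def dr_space_def subspace_V subspace_0)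
  show "x \<otimes>\<^bsub>dr_group V Z J\<^esub> y \<otimes>\<^bsub>dr_group V Z J\<^esub> w = x \<otimes>\<^bsub>dr_group V Z J\<^esub> (y \<otimes>\<^bsub>dr_group V Z J\<^esub> w)"
    if "x \<in> carrier (dr_group V Z J)" "y \<in> carrier (dr_group V Z J)" "w \<in> carrier (dr_group V Z J)"
    for x y w
    using that
    by (auto simp: dr_group_def dr_space_def subspace_V subspace_scale br_add_left br_add_right
        br_scale_left br_scale_right real_sqrt_mult algebra_simps simp flip: scaleR_add_left)
  show "\<exists>y\<in>carrier (dr_group V Z J). y \<otimes>\<^bsub>dr_group V Z J\<^esub> x = \<one>\<^bsub>dr_group V Z J\<^esub>"
    if x: "x \<in> carrier (dr_group V Z J)" for x
  proof -
    obtain v z t where "x = (v, z, t)" "v \<in> V" "z \<in> Z" "t > 0"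
      using x by (auto simp: dr_group_def dr_space_def)
    then show ?thesis
      unfolding dr_group_def using dr_left_inverse[of v z t] by (auto simp del: dr_mult.simps)
  qed
qed

lemma dr_space_mono: "W \<subseteq> V \<Longrightarrow> dr_space W Z \<subseteq> dr_space V Z"
  by (auto simp: dr_space_def)

lemma inv_dr:
  assumes "v \<in> V" "z \<in> Z" "t > 0"
  shows "inv\<^bsub>dr_group V Z J\<^esub> (v, z, t) = ((- inverse (sqrt t)) *\<^sub>R v, (- inverse t) *\<^sub>R z, inverse t)"
  using assms dr_left_inverse[OF assms]
  by (intro group.inv_equality[OF group_dr]) (simp_all add: dr_group_def dr_space_def)

lemma subgroup_dr:
  assumes W: "clifford_submodule V Z J W"
  shows "subgroup (dr_space W Z) (dr_group V Z J)"
proof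
  note W' = clifford_submoduleD[OF W]
  show "dr_space W Z \<subseteq> carrier (dr_group V Z J)"
    using dr_space_mono[OF W'(2)] by (simp add: dr_group_def)
  show "\<one>\<^bsub>dr_group V Z J\<^esub> \<in> dr_space W Z"
    using W' by (simp add: dr_group_def dr_space_def subspace_Z subspace_0)
  show "x \<otimes>\<^bsub>dr_group V Z J\<^esub> y \<in> dr_space W Z" if "x \<in> dr_space W Z" "y \<in> dr_space W Z" for x y
    using W' that
    by (auto simp: dr_group_def dr_space_def subspace_Z subspace_add subspace_scale br_in subset_iff)
  show "inv\<^bsub>dr_group V Z J\<^esub> x \<in> dr_space W Z" if x: "x \<in> dr_space W Z" for x
  proof -
    obtain v z t where "x = (v, z, t)" "v \<in> W" "z \<in> Z" "t > 0"
      using x by (auto simp: dr_space_def)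
    moreover from this have "(- inverse (sqrt t)) *\<^sub>R v \<in> W" "(- inverse t) *\<^sub>R z \<in> Z"
      using W' subspace_Z subspace_scale by blast+
    ultimately show ?thesis
      using W' inv_dr[of v z t] by (auto simp: dr_space_def)
  qed
qed

lemma hom_dr:
  assumes W: "clifford_submodule V Z J W"
  shows "(\<lambda>p. p) \<in> hom (dr_group W Z (J_restrict J W)) (dr_group V Z J)"
  using dr_space_mono[OF clifford_submoduleD(2)[OF W]]
  by (auto simp: hom_def dr_group_def dr_space_def)

section \<open>Lie algebras, left-invariant fields and the Lie bracket\<close>

lemma lie_algebra_of_dr:
  assumes W: "clifford_submodule V Z J W"
  shows "lie_algebra_of (dr_group V Z J) (dr_space W Z) = dr_tangent W Z"
proof (intro equalityI subsetI)
  note W' = clifford_submoduleD[OF W]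
  fix X assume "X \<in> lie_algebra_of (dr_group V Z J) (dr_space W Z)"
  then obtain \<gamma> where \<gamma>: "\<And>r. \<gamma> r \<in> dr_space W Z" "(\<gamma> has_vector_derivative X) (at 0)"
    unfolding lie_algebra_of_def by auto
  have sub: "subspace (dr_tangent W Z)"
    unfolding dr_tangent_def using W' subspace_Z by (intro subspace_Times) auto
  have in_tangent: "\<gamma> r \<in> dr_tangent W Z" for r
    using \<gamma>(1)[of r] by (auto simp: dr_space_def dr_tangent_def)
  \<comment> \<open>The curve runs in a linear subspace, so the projection \<open>?P\<close> leaves
    it unchanged; uniqueness of derivatives then makes its velocity a fixed point of
    \<open>?P\<close>.\<close>
  let ?P = "orth_proj (dr_tangent W Z)"
  have "bounded_linear ?P"
    using linear_orth_proj[OF sub] by (simp add: linear_conv_bounded_linear)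
  from bounded_linear.has_vector_derivative[OF this \<gamma>(2)]
  have "(\<gamma> has_vector_derivative ?P X) (at 0)"
    by (simp add: orth_proj_ident[OF sub in_tangent])
  with \<gamma>(2) have "X = ?P X"
    by (rule vector_derivative_unique_at)
  then show "X \<in> dr_tangent W Z"
    using orth_proj_in[OF sub, of X] by simp
next
  note W' = clifford_submoduleD[OF W]
  fix X assume "X \<in> dr_tangent W Z"
  then obtain x y a where X: "X = (x, y, a)" and xy: "x \<in> W" "y \<in> Z"
    by (auto simp: dr_tangent_def)
  \<comment> \<open>Both one-parameter subgroups below keep the first coordinate on the line through
    \<open>x\<close>, where the bracket term of the product vanishes.\<close>
  have br0: "br (c *\<^sub>R x) (d *\<^sub>R x) = 0" for c d
    using xy W'(2) subspace_V by (auto simp: br_scale_left br_scale_right subspace_scale br_self)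
  show "X \<in> lie_algebra_of (dr_group V Z J) (dr_space W Z)"
  proof (cases "a = 0")
    case True
    define \<gamma> where "\<gamma> r = (r *\<^sub>R x, r *\<^sub>R y, 1::real)" for r :: real
    have "(\<gamma> has_vector_derivative X) (at 0)"
      unfolding \<gamma>_def X True
      by (auto intro!: derivative_eq_intros has_vector_derivative_Pair)
    moreover have "\<gamma> r \<in> dr_space W Z" for r
      using xy W' subspace_Z by (simp add: \<gamma>_def dr_space_def subspace_scale)
    moreover have "\<gamma> (r + s) = \<gamma> r \<otimes>\<^bsub>dr_group V Z J\<^esub> \<gamma> s" for r s
      by (simp add: \<gamma>_def dr_group_def br0 scaleR_add_left)
    ultimately show ?thesis unfolding lie_algebra_of_def by blast
  next
    case False
    \<comment> \<open>\<open>f b\<close> solves the equation \<open>f_add\<close> that the group law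
      imposes on a coordinate scaled by \<open>exp (b * r)\<close>. The first coordinate scales by
      the square root of the third, hence \<open>b = a / 2\<close> there and \<open>b = a\<close> in
      the second. As \<open>b\<close> tends to 0, \<open>f b r\<close> tends to \<open>r\<close>,
      the straight line of the case \<open>a = 0\<close>.\<close>
    define f where "f b r = (exp (b * r) - 1) / b" for b r :: real
    have f_add: "f b (r + s) = f b r + exp (b * r) * f b s" if "b \<noteq> 0" for b r s
      using that by (simp add: f_def exp_add field_simps)
    have f_deriv: "(f b has_real_derivative 1) (at 0)" if "b \<noteq> 0" for b
      unfolding f_def
      using that by (auto intro!: derivative_eq_intros)
    define \<gamma> where "\<gamma> r = (f (a/2) r *\<^sub>R x, f a r *\<^sub>R y, exp (a * r))" for r
    have "((\<lambda>r. exp (a * r)) has_vector_derivative a) (at 0)"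
      unfolding has_real_derivative_iff_has_vector_derivative[symmetric]
      by (auto intro!: derivative_eq_intros)
    then have "(\<gamma> has_vector_derivative X) (at 0)"
      unfolding \<gamma>_def X using False
        has_vector_derivative_scaleR_const[OF f_deriv, of "a / 2" x]
        has_vector_derivative_scaleR_const[OF f_deriv, of a y]
      by (intro has_vector_derivative_Pair) auto
    moreover have "\<gamma> r \<in> dr_space W Z" for r
      using xy W' subspace_Z by (simp add: \<gamma>_def dr_space_def subspace_scale)
    moreover have "sqrt (exp (a * r)) = exp (a / 2 * r)" for r
      by (rule real_sqrt_unique) (simp_all flip: exp_double)
    then have "\<gamma> (r + s) = \<gamma> r \<otimes>\<^bsub>dr_group V Z J\<^esub> \<gamma> s" for r s
      using False by (simp add: \<gamma>_def dr_group_def br0 f_add exp_add distrib_left scaleR_add_left)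
    ultimately show ?thesis unfolding lie_algebra_of_def by blast
  qed
qed

text \<open>For a fixed left factor the product is affine in the right factor, so the derivative is
  read off as the coefficient of \<open>r\<close>.\<close>

lemma left_invariant_field_dr:
  assumes "v \<in> V" "x \<in> V"
  shows "left_invariant_field (dr_group V Z J) (x, y, a) (v, z, t) =
    (sqrt t *\<^sub>R x, t *\<^sub>R y + (sqrt t / 2) *\<^sub>R br v x, t * a)"
proof -
  have "(\<lambda>r. (v, z, t) \<otimes>\<^bsub>dr_group V Z J\<^esub> (\<one>\<^bsub>dr_group V Z J\<^esub> + r *\<^sub>R (x, y, a))) =
    (\<lambda>r. (v, z, t) + r *\<^sub>R (sqrt t *\<^sub>R x, t *\<^sub>R y + (sqrt t / 2) *\<^sub>R br v x, t * a))"
    using assms by (auto simp: dr_group_def br_scale_right algebra_simps)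
  then show ?thesis
    unfolding left_invariant_field_def
    by (auto intro!: vector_derivative_at derivative_eq_intros)
qed

lemma lie_bracket_dr:
  assumes "x \<in> V" "x' \<in> V"
  shows "lie_bracket (dr_group V Z J) (x, y, a) (x', y', a') =
    ((a / 2) *\<^sub>R x' - (a' / 2) *\<^sub>R x, a *\<^sub>R y' - a' *\<^sub>R y + (1/2) *\<^sub>R (br x x' - br x' x), 0)"
proof -
  have one: "\<one>\<^bsub>dr_group V Z J\<^esub> = (0, 0, 1)"
    by (simp add: dr_group_def)
  \<comment> \<open>The two terms of the commutator are one computation with the roles of the
    vectors exchanged. Their last components \<open>a * a'\<close> cancel in the difference.\<close>
  have *: "vector_derivative (\<lambda>r. left_invariant_field (dr_group V Z J) (x', y', a')
      (\<one>\<^bsub>dr_group V Z J\<^esub> + r *\<^sub>R (x, y, a))) (at 0) =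
    ((a / 2) *\<^sub>R x', a *\<^sub>R y' + (1/2) *\<^sub>R br x x', a * a')"
    if x: "x \<in> V" "x' \<in> V" for x x' :: 'v and y y' :: 'z and a a' :: real
  proof -
    have eq: "(\<lambda>r. left_invariant_field (dr_group V Z J) (x', y', a')
        (\<one>\<^bsub>dr_group V Z J\<^esub> + r *\<^sub>R (x, y, a))) =
      (\<lambda>r. (sqrt (1 + r * a) *\<^sub>R x',
        (1 + r * a) *\<^sub>R y' + (sqrt (1 + r * a) * r / 2) *\<^sub>R br x x', (1 + r * a) * a'))"
      using x subspace_V
      by (auto simp: one left_invariant_field_dr subspace_scale br_scale_left)
    have d: "((\<lambda>r. sqrt (1 + r * a)) has_real_derivative a / 2) (at 0)"
      "((\<lambda>r. 1 + r * a) has_real_derivative a) (at 0)"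
      "((\<lambda>r. sqrt (1 + r * a) * r / 2) has_real_derivative 1 / 2) (at 0)"
      "((\<lambda>r. (1 + r * a) * a') has_real_derivative a * a') (at 0)"
      by (auto intro!: derivative_eq_intros)
    show ?thesis
      unfolding eq
      by (intro vector_derivative_at has_vector_derivative_Pair has_vector_derivative_add
          has_vector_derivative_scaleR_const d
          d(4)[unfolded has_real_derivative_iff_has_vector_derivative])
  qed
  show ?thesis
    unfolding lie_bracket_def *[OF assms] *[OF assms(2,1)] by (simp add: algebra_simps)
qed

lemma closed_lie_subgroup_dr:
  assumes W: "clifford_submodule V Z J W"
  shows "closed_lie_subgroup_with_algebra (dr_group V Z J) (dr_space W Z) (dr_tangent W Z)"
  unfolding closed_lie_subgroup_with_algebra_def lie_subalgebra_def
proof (intro conjI ballI)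
  note W' = clifford_submoduleD[OF W]
  \<comment> \<open>Finite-dimensional subspaces are closed, so this intersection is relatively
    closed; connectedness below comes from convexity.\<close>
  have "dr_space W Z = (W \<times> UNIV) \<inter> carrier (dr_group V Z J)"
    using W'(2) by (auto simp: dr_space_def dr_group_def)
  then show "closedin (top_of_set (carrier (dr_group V Z J))) (dr_space W Z)"
    using closed_subspace[OF W'(1)] by (auto simp: closedin_closed intro!: closed_Times)
  show "connected (dr_space W Z)"
    unfolding dr_space_def
    using W' subspace_Z by (intro convex_connected convex_Times subspace_imp_convex convex_real_interval)
  show "subspace (dr_tangent W Z)"
    unfolding dr_tangent_def using W' subspace_Z by (intro subspace_Times) auto
  show "dr_tangent W Z \<subseteq> lie_algebra_of (dr_group V Z J) (carrier (dr_group V Z J))"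
    using W' lie_algebra_of_dr[OF clifford_submodule_self] by (auto simp: dr_group_def dr_tangent_def)
  show "lie_bracket (dr_group V Z J) X Y \<in> dr_tangent W Z"
    if "X \<in> dr_tangent W Z" "Y \<in> dr_tangent W Z" for X Y
    using that W' subspace_Z
    by (auto simp: dr_tangent_def lie_bracket_dr subset_iff subspace_add subspace_diff
        subspace_scale br_in)
qed (use W in \<open>simp_all add: group_dr subgroup_dr lie_algebra_of_dr\<close>)

text \<open>The identity serves as the derivative of the inclusion, and on vectors tangent to the
  subgroup the two metrics agree because their brackets do.\<close>

lemma isometric_embedding_dr:
  assumes W: "clifford_submodule V Z J W"
  shows "isometric_embedding
    (dr_space W Z) (dr_tangent W Z) (dr_metric Z (J_restrict J W))
    (dr_space V Z) (dr_metric Z J) (\<lambda>p. p)"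
  unfolding isometric_embedding_def
proof (intro conjI ballI)
  note W' = clifford_submoduleD[OF W]
  show "(\<lambda>p. p) ` dr_space W Z \<subseteq> dr_space V Z"
    using dr_space_mono[OF W'(2)] by simp
  show "smooth_map_on (dr_space W Z) (\<lambda>p. p)"
    by (simp add: smooth_map_on_def C_k_on_id)
  show "\<exists>\<psi>. homeomorphism (dr_space W Z) ((\<lambda>p. p) ` dr_space W Z) (\<lambda>p. p) \<psi>"
    by (auto simp: homeomorphism_def)
  show "\<exists>D. ((\<lambda>p. p) has_derivative D) (at p within dr_space W Z) \<and>
      (\<forall>X\<in>dr_tangent W Z. \<forall>Y\<in>dr_tangent W Z.
        dr_metric Z J p (D X) (D Y) = dr_metric Z (J_restrict J W) p X Y)"
    if "p \<in> dr_space W Z" for p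
    by (rule exI[of _ "\<lambda>X. X"]) (cases p; auto simp: dr_tangent_def)
qed


section \<open>Critical points and focal varieties\<close>

text \<open>The quotient rule applied to \<open>N r / (t + r * a)\<close>: a vanishing derivative at
  0 makes the numerator \<open>N' * t - N 0 * a\<close> vanish. The condition
  \<open>t + r * a > 0\<close> cuts out the open set of parameters for which the line stays in the
  half-space.\<close>

lemma critical_point_along_line:
  fixes x :: 'v and y :: 'z
  assumes crit: "critical_point (dr_space V Z) F (v, z, t)"
    and d: "x \<in> V" "y \<in> Z"
    and F: "\<And>r. t + r * a > 0 \<Longrightarrow>
      F (v + r *\<^sub>R x, z + r *\<^sub>R y, t + r * a) = c + N r / (t + r * a)"
    and N: "(N has_real_derivative N') (at 0)"
  shows "N' * t = N 0 * a"
proof -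
  let ?S = "{r. t + r * a > 0}"
  let ?\<gamma> = "\<lambda>r. (v, z, t) + r *\<^sub>R (x, y, a)"
  have p: "v \<in> V" "z \<in> Z" "t > 0"
    and F': "(F has_derivative (\<lambda>_. 0)) (at (?\<gamma> 0) within dr_space V Z)"
    using crit by (auto simp: critical_point_def dr_space_def)
  have S: "open ?S" "0 \<in> ?S"
    using p by (auto intro!: open_Collect_less continuous_intros)
  have sub: "?\<gamma> ` ?S \<subseteq> dr_space V Z"
    using p d subspace_V subspace_Z by (auto simp: dr_space_def subspace_add subspace_scale)
  have "(?\<gamma> has_derivative (\<lambda>r. r *\<^sub>R (x, y, a))) (at 0 within ?S)"
    by (auto intro!: derivative_eq_intros)
  from diff_chain_within[OF this has_derivative_subset[OF F' sub]]
  have "(F \<circ> ?\<gamma> has_derivative (\<lambda>r. 0)) (at 0)"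
    using S by (simp add: o_def at_within_open[of 0 ?S])
  then have "((\<lambda>r. F (?\<gamma> r)) has_real_derivative 0) (at 0)"
    by (simp add: has_field_derivative_def o_def flip: lambda_zero)
  then have "((\<lambda>r. c + N r / (t + r * a)) has_real_derivative 0) (at 0)"
    by (rule has_field_derivative_transform_within_open[OF _ S]) (simp add: F)
  moreover have "((\<lambda>r. c + N r / (t + r * a)) has_real_derivative (N' * t - N 0 * a) / t\<^sup>2) (at 0)"
    using p by (auto intro!: derivative_eq_intros N simp: power2_eq_square)
  ultimately show ?thesis
    using p DERIV_unique by fastforce
qed

text \<open>A common normal form of both functions: \<open>U = Vp\<close> and
  \<open>c = 4 * l\<close> give the function on the big space, \<open>U = {0}\<close> and
  \<open>c = 0\<close> the one on the subgroup.\<close>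

lemma critical_point_iff:
  fixes z0 :: 'z and v0 :: 'v and l c :: real and U :: "'v set"
  defines "dev \<equiv> \<lambda>(v, z, t). t + (norm (v - v0))\<^sup>2 / 4 - 2 * l"
    and "twist \<equiv> \<lambda>(v, z, t). z - z0 + (1/2) *\<^sub>R br v v0"
  assumes U: "subspace U" "U \<subseteq> V" and v0: "v0 \<in> V" and z0: "z0 \<in> Z" and l: "l > 0"
    and F: "\<And>v z t. (v, z, t) \<in> dr_space V Z \<Longrightarrow>
      F (v, z, t) = c + ((dev (v, z, t))\<^sup>2 + 2 * l * (norm (orth_proj U (v - v0)))\<^sup>2
        + (norm (twist (v, z, t)))\<^sup>2) / t"
    and p: "(v, z, t) \<in> dr_space V Z"
  shows "critical_point (dr_space V Z) F (v, z, t) \<longleftrightarrow>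
    dev (v, z, t) = 0 \<and> orth_proj U (v - v0) = 0 \<and> twist (v, z, t) = 0"
proof
  let ?P = "orth_proj U"
  define a where "a = v - v0"
  define u where "u = ?P a"
  define \<zeta> where "\<zeta> = twist (v, z, t)"
  define A where "A = t + (norm a)\<^sup>2 / 4"
  have p': "v \<in> V" "z \<in> Z" "t > 0"
    using p by (auto simp: dr_space_def)
  have mem: "a \<in> V" "u \<in> U" "u \<in> V" "\<zeta> \<in> Z"
    using p' v0 z0 U subspace_V subspace_Z
    by (auto simp: a_def u_def \<zeta>_def twist_def subspace_diff subspace_add subspace_scale
        orth_proj_in br_in subset_iff)
  have A: "A > 0"
    using p' by (simp add: A_def add_pos_nonneg)
  have P_lin: "?P (x + y) = ?P x + ?P y" "?P (r *\<^sub>R x) = r *\<^sub>R ?P x" for x y r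
    using linear_orth_proj[OF U(1)] by (simp_all add: linear_add linear_cmul)
  have Pu: "?P u = u"
    using orth_proj_ident[OF U(1) mem(2)] .
  have au: "a \<bullet> u = (norm u)\<^sup>2"
    using inner_orth_proj[OF U(1) mem(2), of a] by (simp add: u_def power2_norm_eq_inner)
  have line: "F (v + r *\<^sub>R x, z + r *\<^sub>R y, t + r * s) =
      c + ((t + r * s + (norm (a + r *\<^sub>R x))\<^sup>2 / 4 - 2 * l)\<^sup>2
        + 2 * l * (norm (u + r *\<^sub>R ?P x))\<^sup>2
        + (norm (\<zeta> + r *\<^sub>R (y + (1/2) *\<^sub>R br x v0)))\<^sup>2) / (t + r * s)"
    if "x \<in> V" "y \<in> Z" "t + r * s > 0" for x y r s
  proof -
    have "(v + r *\<^sub>R x, z + r *\<^sub>R y, t + r * s) \<in> dr_space V Z"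
      using that p' subspace_V subspace_Z by (simp add: dr_space_def subspace_add subspace_scale)
    moreover have eq: "v + r *\<^sub>R x - v0 = a + r *\<^sub>R x"
      by (simp add: a_def)
    moreover have "twist (v + r *\<^sub>R x, z + r *\<^sub>R y, t + r * s) = \<zeta> + r *\<^sub>R (y + (1/2) *\<^sub>R br x v0)"
      using that p' subspace_V
      by (simp add: twist_def \<zeta>_def br_add_left br_scale_left subspace_scale algebra_simps)
    ultimately show ?thesis
      by (simp add: F dev_def P_lin u_def eq)
  qed
  assume crit: "critical_point (dr_space V Z) F (v, z, t)"
  have "\<zeta> = 0"
  proof -
    \<comment> \<open>Along \<open>(0, \<zeta>, 0)\<close> the twist is multiplied by
      \<open>1 + r\<close> and everything else in the formula is constant.\<close>
    define N where "N r = (A - 2 * l)\<^sup>2 + 2 * l * (norm u)\<^sup>2 + (1 + r)\<^sup>2 * (norm \<zeta>)\<^sup>2" for r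
    have sc: "\<zeta> + r *\<^sub>R \<zeta> = (1 + r) *\<^sub>R \<zeta>" for r
      by (simp add: scaleR_add_left)
    have "F (v + r *\<^sub>R 0, z + r *\<^sub>R \<zeta>, t + r * 0) = c + N r / (t + r * 0)" for r
      using line[of 0 \<zeta> r 0] p' mem subspace_V br_scale_left[of 0 0 v0] linear_0[OF linear_orth_proj[OF U(1)]]
      by (simp add: N_def A_def sc power_mult_distrib subspace_0)
    moreover have "(N has_real_derivative 2 * (norm \<zeta>)\<^sup>2) (at 0)"
      unfolding N_def by (auto intro!: derivative_eq_intros)
    ultimately have "2 * (norm \<zeta>)\<^sup>2 * t = N 0 * 0"
      by (intro critical_point_along_line[OF crit, of 0 \<zeta> 0 c N])
        (use mem subspace_V in \<open>auto simp: subspace_0\<close>)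
    with p' show ?thesis by simp
  qed
  have "u = 0"
  proof -
    \<comment> \<open>Along \<open>(u, 0, 0)\<close> the twist, already zero at the point, enters
      only at second order. The first-order terms add up to
      \<open>(A - 2 * l) + 4 * l = A + 2 * l\<close> times \<open>(norm u)\<^sup>2\<close>, and this
      factor is positive.\<close>
    define N where "N r = (t + ((norm a)\<^sup>2 + (2 * r + r\<^sup>2) * (norm u)\<^sup>2) / 4 - 2 * l)\<^sup>2
      + 2 * l * ((1 + r)\<^sup>2 * (norm u)\<^sup>2) + r\<^sup>2 * (norm ((1/2) *\<^sub>R br u v0))\<^sup>2" for r
    have "u + r *\<^sub>R u = (1 + r) *\<^sub>R u" for r
      by (simp add: scaleR_add_left)
    then have nrm_u: "(norm (u + r *\<^sub>R u))\<^sup>2 = (1 + r)\<^sup>2 * (norm u)\<^sup>2" for r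
      by (simp add: power_mult_distrib)
    have nrm_a: "(norm (a + r *\<^sub>R u))\<^sup>2 = (norm a)\<^sup>2 + (2 * r + r\<^sup>2) * (norm u)\<^sup>2" for r
      using au unfolding power2_norm_eq_inner
      by (simp add: inner_add_left inner_add_right inner_commute power2_eq_square algebra_simps)
    have nrm_br: "(norm (0 + r *\<^sub>R (0 + (1/2) *\<^sub>R br u v0)))\<^sup>2 = r\<^sup>2 * (norm ((1/2) *\<^sub>R br u v0))\<^sup>2" for r
      by (simp add: power_divide power_mult_distrib)
    have "F (v + r *\<^sub>R u, z + r *\<^sub>R 0, t + r * 0) = c + N r / (t + r * 0)" for r
      using line[of u 0 r 0] p' mem subspace_0[OF subspace_Z]
      unfolding N_def Pu \<open>\<zeta> = 0\<close> nrm_u nrm_a nrm_br by simp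
    moreover have "(N has_real_derivative (A + 2 * l) * (norm u)\<^sup>2) (at 0)"
      unfolding N_def A_def by (auto intro!: derivative_eq_intros simp: field_simps)
    ultimately have "(A + 2 * l) * (norm u)\<^sup>2 * t = N 0 * 0"
      by (intro critical_point_along_line[OF crit, of u 0 0 c N])
        (use mem subspace_Z in \<open>auto simp: subspace_0\<close>)
    with p' A l show ?thesis by simp
  qed
  \<comment> \<open>the direction of the dilation \<open>(a, \<zeta>, t) \<mapsto> (e\<^sup>s a, e\<^bsup>2s\<^esup> \<zeta>, e\<^bsup>2s\<^esup> t)\<close>\<close>
  have "A = 2 * l"
  proof -
    define N where "N r = (t + r * (2 * t) + (1 + r)\<^sup>2 * (norm a)\<^sup>2 / 4 - 2 * l)\<^sup>2" for r
    have "a + r *\<^sub>R a = (1 + r) *\<^sub>R a" for r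
      by (simp add: scaleR_add_left)
    then have nrm_a: "(norm (a + r *\<^sub>R a))\<^sup>2 = (1 + r)\<^sup>2 * (norm a)\<^sup>2" for r
      by (simp add: power_mult_distrib)
    \<comment> \<open>This choice cancels the change of the twist caused by moving the first
      coordinate along \<open>a\<close>, so the twist stays zero on the whole line.\<close>
    define y where "y = - ((1/2) *\<^sub>R br a v0)"
    have y: "y \<in> Z"
      unfolding y_def by (intro subspace_neg subspace_scale subspace_Z br_in mem)
    have nrm_u: "2 * l * (norm (u + r *\<^sub>R ?P a))\<^sup>2 = 0" for r
      using \<open>u = 0\<close> by (simp flip: u_def)
    have nrm_\<zeta>: "(norm (\<zeta> + r *\<^sub>R (y + (1/2) *\<^sub>R br a v0)))\<^sup>2 = 0" for r
      by (simp add: y_def \<open>\<zeta> = 0\<close>)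
    have "F (v + r *\<^sub>R a, z + r *\<^sub>R y, t + r * (2 * t)) = c + N r / (t + r * (2 * t))"
      if "t + r * (2 * t) > 0" for r
      using line[OF mem(1) y that] unfolding nrm_a nrm_u nrm_\<zeta> N_def add_0_right .
    moreover have "(N has_real_derivative 4 * (A - 2 * l) * A) (at 0)"
      unfolding N_def A_def by (auto intro!: derivative_eq_intros simp: field_simps)
    ultimately have "4 * (A - 2 * l) * A * t = N 0 * (2 * t)"
      by (intro critical_point_along_line[OF crit, of a y "2 * t" c N]) (use mem y in auto)
    \<comment> \<open>Since \<open>N 0 = (A - 2 * l)\<^sup>2\<close>, the equation factors, and
      \<open>A + 2 * l\<close> and \<open>t\<close> are positive.\<close>
    then have "(A - 2 * l) * (A + 2 * l) * t = 0"
      by (simp add: N_def A_def power2_eq_square algebra_simps)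
    with p' A l show ?thesis by simp
  qed
  with \<open>u = 0\<close> \<open>\<zeta> = 0\<close>
  show "dev (v, z, t) = 0 \<and> orth_proj U (v - v0) = 0 \<and> twist (v, z, t) = 0"
    by (simp add: dev_def u_def \<zeta>_def A_def a_def)
next
  let ?M = "dr_space V Z"
  assume zero: "dev (v, z, t) = 0 \<and> orth_proj U (v - v0) = 0 \<and> twist (v, z, t) = 0"
  \<comment> \<open>A version of the numerator that is differentiable on the ambient space: the
    projection onto \<open>V\<close> linearizes the bracket and acts as the identity on the points
    of the half-space.\<close>
  define f where "f q = (dev q)\<^sup>2 + 2 * l * (norm (orth_proj U (fst q - v0)))\<^sup>2
    + (norm (fst (snd q) - z0 + (1/2) *\<^sub>R br (orth_proj V (fst q)) v0))\<^sup>2" for q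
  have p': "v \<in> V" "t > 0"
    using p by (auto simp: dr_space_def)
  have dev: "dev = (\<lambda>q. snd (snd q) + (fst q - v0) \<bullet> (fst q - v0) / 4 - 2 * l)"
    by (auto simp: dev_def power2_norm_eq_inner)
  note d_fst = has_derivative_fst[OF has_derivative_ident]
    and d_snd = has_derivative_snd[OF has_derivative_ident]
  have d_v: "((\<lambda>q. fst q - v0) has_derivative fst) (at (v, z, t) within ?M)"
    using has_derivative_diff[OF d_fst has_derivative_const] by simp
  have D1: "(dev has_derivative (\<lambda>q. snd (snd q) + 2 * ((v - v0) \<bullet> fst q) / 4)) (at (v, z, t) within ?M)"
    using has_derivative_diff[OF has_derivative_add[OF has_derivative_snd[OF d_snd]
          has_derivative_mult_right[OF has_derivative_inner[OF d_v d_v], of "1/4"]]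
        has_derivative_const[of "2 * l"]]
    unfolding dev by (simp add: inner_commute)
  from has_derivative_compose[OF d_v linear_imp_has_derivative[OF linear_orth_proj[OF U(1)]]]
  have D2: "((\<lambda>q. orth_proj U (fst q - v0)) has_derivative (\<lambda>q. orth_proj U (fst q)))
      (at (v, z, t) within ?M)" .
  from has_derivative_compose[OF d_fst linear_imp_has_derivative[OF linear_br_left]]
  have "((\<lambda>q. br (orth_proj V (fst q)) v0) has_derivative (\<lambda>q. br (orth_proj V (fst q)) v0))
      (at (v, z, t) within ?M)" .
  then have D3: "((\<lambda>q. fst (snd q) - z0 + (1/2) *\<^sub>R br (orth_proj V (fst q)) v0) has_derivative
      (\<lambda>q. fst (snd q) + (1/2) *\<^sub>R br (orth_proj V (fst q)) v0)) (at (v, z, t) within ?M)"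
    using has_derivative_add[OF has_derivative_diff[OF has_derivative_fst[OF d_snd]
          has_derivative_const[of z0]] has_derivative_scaleR_right[of _ _ _ "1/2"]] by simp
  have V_id: "orth_proj V x = x" if "x \<in> V" for x
    using orth_proj_ident[OF subspace_V that] .
  have f0: "f (v, z, t) = 0"
    using zero p' by (simp add: f_def twist_def V_id)
  have "(f has_derivative (\<lambda>q. 0 + 2 * l * 0 + 0)) (at (v, z, t) within ?M)"
    unfolding f_def
    by (intro has_derivative_add has_derivative_mult_right has_derivative_norm_power2_zero[OF D2]
        has_derivative_norm_power2_zero[OF D3]
        has_derivative_norm_power2_zero[OF D1, unfolded real_norm_def power2_abs])
      (use zero p' in \<open>auto simp: twist_def V_id\<close>)
  then have f': "(f has_derivative (\<lambda>q. 0)) (at (v, z, t) within ?M)" by simp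
  \<comment> \<open>Both \<open>f\<close> and its derivative vanish at the point, so the derivative
    of the denominator contributes nothing.\<close>
  have "((\<lambda>q. c + f q / snd (snd q)) has_derivative (\<lambda>_. 0)) (at (v, z, t) within ?M)"
    using has_derivative_add[OF has_derivative_const
        has_derivative_divide[OF f' has_derivative_snd[OF d_snd]], of c] p' f0 by simp
  then have "(F has_derivative (\<lambda>_. 0)) (at (v, z, t) within ?M)"
  proof (rule has_derivative_transform[OF p, rotated])
    show "F q = c + f q / snd (snd q)" if "q \<in> ?M" for q
      using that by (cases q) (auto simp: F f_def twist_def dr_space_def V_id)
  qed
  then show "critical_point ?M F (v, z, t)"
    using p by (simp add: critical_point_def)
qed

text \<open>The critical set and the level set of the minimum \<open>c\<close> are the same set
  \<open>E\<close>, so \<open>c\<close> is the only possible critical value; \<open>E\<close> must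
  also be shown nonempty for \<open>c\<close> to be one.\<close>

lemma focal_varieties_eq:
  fixes z0 :: 'z and v0 :: 'v and l c :: real and U :: "'v set"
  assumes U: "subspace U" "U \<subseteq> V" and v0: "v0 \<in> V" and z0: "z0 \<in> Z" and l: "l > 0"
    and F: "\<And>v z t. (v, z, t) \<in> dr_space V Z \<Longrightarrow>
      F (v, z, t) = c + ((t + (norm (v - v0))\<^sup>2 / 4 - 2 * l)\<^sup>2
        + 2 * l * (norm (orth_proj U (v - v0)))\<^sup>2
        + (norm (z - z0 + (1/2) *\<^sub>R br v v0))\<^sup>2) / t"
  shows "focal_varieties (dr_space V Z) F =
    {{(v, z, t) \<in> dr_space V Z. t + (norm (v - v0))\<^sup>2 / 4 = 2 * l \<and>
      orth_proj U (v - v0) = 0 \<and> z - z0 + (1/2) *\<^sub>R br v v0 = 0}}"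
proof -
  let ?M = "dr_space V Z"
  define E where "E = {(v, z, t) \<in> ?M. t + (norm (v - v0))\<^sup>2 / 4 = 2 * l \<and>
      orth_proj U (v - v0) = 0 \<and> z - z0 + (1/2) *\<^sub>R br v v0 = 0}"
  have crit: "critical_point ?M F p \<longleftrightarrow> p \<in> E" for p
  proof (cases p)
    case (fields v z t)
    have "critical_point ?M F (v, z, t) \<longleftrightarrow> (v, z, t) \<in> E" if "(v, z, t) \<in> ?M"
      using critical_point_iff[OF U v0 z0 l _ that, of F c] F that by (auto simp: E_def)
    then show ?thesis
      unfolding fields by (auto simp: critical_point_def E_def)
  qed
  \<comment> \<open>The numerator is a sum of nonnegative terms with positive weight
    \<open>2 * l\<close>, so the value \<open>c\<close> forces each of them to vanish.\<close>
  have level: "F p = c \<longleftrightarrow> p \<in> E" if "p \<in> ?M" for p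
  proof (cases p)
    case (fields v z t)
    then have "t > 0" using that by (auto simp: dr_space_def)
    then show ?thesis
      using that l F[of v z t] unfolding fields
      by (auto simp: E_def add_nonneg_eq_0_iff)
  qed
  \<comment> \<open>With \<open>v = v0\<close> and \<open>z = z0\<close> all deviations vanish, the
    twist because \<open>br v0 v0 = 0\<close>; then \<open>t = 2 * l\<close> is forced, and it is
    positive.\<close>
  have "(v0, z0, 2 * l) \<in> E"
    using v0 z0 l linear_0[OF linear_orth_proj[OF U(1)]] by (simp add: E_def dr_space_def br_self)
  moreover have E: "E \<subseteq> ?M" by (auto simp: E_def)
  ultimately have "(\<exists>p. p \<in> E \<and> F p = b) \<longleftrightarrow> b = c" for b
    using level by blast
  moreover have "{q \<in> ?M. F q = c} = E"
    using level E by blast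
  ultimately have "focal_varieties ?M F = {E}"
    by (simp add: focal_varieties_def crit)
  then show ?thesis by (simp add: E_def)
qed

section \<open>The two functions in normal form\<close>

lemma focal_varieties_dr_F_point:
  assumes "v0 \<in> V" "z0 \<in> Z" "l > 0"
  shows "focal_varieties (dr_space V Z) (dr_F_point Z J (v0, z0, - 2 * l)) =
    {{(v, z, t) \<in> dr_space V Z. t + (norm (v - v0))\<^sup>2 / 4 = 2 * l \<and> z - z0 + (1/2) *\<^sub>R br v v0 = 0}}"
proof -
  have triv: "orth_proj {0} v = 0" for v :: 'v
    using orth_proj_in[of "{0}" v] by simp
  have half: "(norm (w /\<^sub>R 2))\<^sup>2 = (norm w)\<^sup>2 / 4" for w :: 'v
    by (simp add: power_divide)
  have "focal_varieties (dr_space V Z) (dr_F_point Z J (v0, z0, - 2 * l)) =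
    {{(v, z, t) \<in> dr_space V Z. t + (norm (v - v0))\<^sup>2 / 4 = 2 * l \<and>
      orth_proj {0} (v - v0) = 0 \<and> z - z0 + (1/2) *\<^sub>R br v v0 = 0}}"
  proof (rule focal_varieties_eq[OF _ _ assms, of _ _ 0])
    show "dr_F_point Z J (v0, z0, - 2 * l) (v, z, t) =
        0 + ((t + (norm (v - v0))\<^sup>2 / 4 - 2 * l)\<^sup>2 + 2 * l * (norm (orth_proj {0} (v - v0)))\<^sup>2
          + (norm (z - z0 + (1/2) *\<^sub>R br v v0))\<^sup>2) / t" for v z t
      unfolding dr_F_point.simps half triv by (simp add: diff_add_eq add_diff_eq)
  qed (simp_all add: subspace_0[OF subspace_V])
  then show ?thesis by (simp add: triv)
qed

lemma focal_varieties_dr_F_decomp: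
  assumes A: "subspace A" "A \<subseteq> V" and B: "subspace B"
    and V: "orthogonal_direct_sum V A B"
    and v0: "v0 \<in> V" and z0: "z0 \<in> Z" and l: "l > 0"
  shows "focal_varieties (dr_space V Z) (dr_F_decomp Z J A B v0 z0 l) =
    {{(v, z, t) \<in> dr_space V Z. t + (norm (v - v0))\<^sup>2 / 4 = 2 * l \<and>
      orth_proj A (v - v0) = 0 \<and> z - z0 + (1/2) *\<^sub>R br v v0 = 0}}"
proof (rule focal_varieties_eq[OF A v0 z0 l, of _ "4 * l"])
  fix v z and t :: real
  assume "(v, z, t) \<in> dr_space V Z"
  then have v: "v - v0 \<in> V" and t: "t > 0"
    using v0 subspace_V by (auto simp: dr_space_def subspace_diff)
  define a where "a = v - v0"
  define p where "p = orth_proj A a"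
  define m where "m = orth_proj B a"
  have a: "a = p + m"
    unfolding p_def m_def by (rule orth_proj_direct_sum[OF A(1) B V]) (simp add: a_def v)
  have "p \<bullet> m = 0"
    using V orth_proj_in[OF A(1)] orth_proj_in[OF B]
    by (simp add: orthogonal_direct_sum_def orthogonal_def p_def m_def)
  then have "(norm a)\<^sup>2 = (norm p)\<^sup>2 + (norm m)\<^sup>2" "a \<bullet> (p - m) = (norm p)\<^sup>2 - (norm m)\<^sup>2"
    unfolding a by (simp_all add: power2_norm_eq_inner inner_add_left inner_add_right
        inner_diff_right inner_commute)
  then have eq: "(norm (a /\<^sub>R 2))\<^sup>2 = ((norm p)\<^sup>2 + (norm m)\<^sup>2) / 4"
    "(norm a)\<^sup>2 = (norm p)\<^sup>2 + (norm m)\<^sup>2" "a \<bullet> (p - m) = (norm p)\<^sup>2 - (norm m)\<^sup>2"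
    by (simp_all add: power_divide)
  \<comment> \<open>Here \<open>P\<close> and \<open>M\<close> stand for the squared norms of the
    two components. The cross term of the completed square contains \<open>- l * (P + M)\<close>,
    and \<open>l * (P - M) = 2 * l * P - l * (P + M)\<close>, so only the \<open>P\<close> part
    survives.\<close>
  have "1 / t * ((t + (P + M) / 4)\<^sup>2 + N + l * (P - M) + 4 * l\<^sup>2) =
      4 * l + ((t + (P + M) / 4 - 2 * l)\<^sup>2 + 2 * l * P + N) / t" for P M N :: real
  proof -
    have *: "1 / t * L = 4 * l + R / t" if "L = 4 * l * t + R" for L R
      using t that by (simp add: field_simps)
    show ?thesis
      by (rule *) (simp add: power2_eq_square algebra_simps)
  qed
  then show "dr_F_decomp Z J A B v0 z0 l (v, z, t) =
      4 * l + ((t + (norm (v - v0))\<^sup>2 / 4 - 2 * l)\<^sup>2 + 2 * l * (norm (orth_proj A (v - v0)))\<^sup>2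
        + (norm (z - z0 + (1/2) *\<^sub>R br v v0))\<^sup>2) / t"
    unfolding dr_F_decomp.simps a_def[symmetric] p_def[symmetric] m_def[symmetric] eq .
qed

end

section \<open>The left translation between the focal varieties\<close>

theorem proposition6p2:
  fixes V Vp Vm :: "'v::euclidean_space set"
    and Z :: "'z::euclidean_space set"
    and J :: "'z \<Rightarrow> 'v \<Rightarrow> 'v"
    and v0 :: 'v and z0 :: 'z and l :: real
  assumes "damek_ricci V Z J"
    and "clifford_submodule V Z J Vp"
    and "clifford_submodule V Z J Vm"
    and "orthogonal_direct_sum V Vp Vm"
    and "v0 \<in> V" and "z0 \<in> Z" and "l > 0"
  shows "closed_lie_subgroup_with_algebra (dr_group V Z J) (dr_space Vm Z) (dr_tangent Vm Z)
    \<and> damek_ricci Vm Z (J_restrict J Vm)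
    \<and> (\<lambda>p. p) \<in> hom (dr_group Vm Z (J_restrict J Vm)) (dr_group V Z J)
    \<and> isometric_embedding
        (dr_space Vm Z) (dr_tangent Vm Z) (dr_metric Z (J_restrict J Vm))
        (dr_space V Z) (dr_metric Z J) (\<lambda>p. p)
    \<and> (\<exists>\<F> \<F>m.
          focal_varieties (dr_space V Z) (dr_F_decomp Z J Vp Vm v0 z0 l) = {\<F>}
        \<and> focal_varieties (dr_space Vm Z)
            (dr_F_point Z (J_restrict J Vm) (orth_proj Vm v0, z0, - 2 * l)) = {\<F>m}
        \<and> \<F> = dr_mult Z J (orth_proj Vp v0, 0, 1) ` \<F>m)"
proof -
  interpret damek_ricci V Z J by fact
  note Vp = clifford_submoduleD[OF assms(2)] and Vm = clifford_submoduleD[OF assms(3)]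
  define p0 where "p0 = orth_proj Vp v0"
  define m0 where "m0 = orth_proj Vm v0"
  have v0: "v0 = p0 + m0"
    unfolding p0_def m0_def by (rule orth_proj_direct_sum[OF Vp(1) Vm(1) assms(4,5)])
  have p0: "p0 \<in> Vp" and m0: "m0 \<in> Vm"
    unfolding p0_def m0_def by (rule orth_proj_in Vp(1) Vm(1))+
  then have "p0 \<in> V" "m0 \<in> V"
    using Vp(2) Vm(2) by auto
  note p0 = p0 this(1) and m0 = m0 this(2)
  have orth: "x \<bullet> y = 0" "y \<bullet> x = 0" if "x \<in> Vp" "y \<in> Vm" for x y
    using assms(4) that by (auto simp: orthogonal_direct_sum_def orthogonal_def inner_commute)
  have br_pm: "br p0 w = 0" "br w p0 = 0" if "w \<in> Vm" for w
    by (rule br_submodule_orthogonal[OF assms(2) p0(1)] br_submodule_orthogonal[OF assms(3) that],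
        use that p0 orth in simp)+
  \<comment> \<open>Every vector of \<open>V\<close> is the sum of its two projections, so the
    kernel of one is the other summand.\<close>
  have proj: "orth_proj Vp x = 0 \<longleftrightarrow> x \<in> Vm" if "x \<in> V" for x
    using orth_proj_direct_sum[OF Vp(1) Vm(1) assms(4) that] orth_proj_in[OF Vm(1), of x]
      orth_projI[of Vp 0 x] Vp(1) orth by (auto simp: subspace_0)
  define \<F> where "\<F> = {(v, z, t) \<in> dr_space V Z. t + (norm (v - v0))\<^sup>2 / 4 = 2 * l \<and>
      orth_proj Vp (v - v0) = 0 \<and> z - z0 + (1/2) *\<^sub>R br v v0 = 0}"
  define \<F>m where "\<F>m = {(v, z, t) \<in> dr_space Vm Z. t + (norm (v - m0))\<^sup>2 / 4 = 2 * l \<and>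
      z - z0 + (1/2) *\<^sub>R dr_bracket Z (J_restrict J Vm) v m0 = 0}"
  \<comment> \<open>Expanding \<open>br (p0 + m) (p0 + m0)\<close>, the mixed terms vanish by
    \<open>br_pm\<close> and \<open>br p0 p0\<close> by \<open>br_self\<close>. Hence the twists of
    the two functions correspond under the shift by \<open>p0\<close>.\<close>
  have br_v0: "br (p0 + m) v0 = br m m0" if "m \<in> Vm" for m
    using that p0 m0 Vm(2) by (auto simp: v0 br_add_left br_add_right br_pm br_self)
  have "\<F> = dr_mult Z J (p0, 0, 1) ` \<F>m"
  proof (intro equalityI subsetI)
    fix x assume "x \<in> \<F>"
    then obtain v z t where x: "x = (v, z, t)" "v \<in> V" "z \<in> Z" "t > 0"
      "t + (norm (v - v0))\<^sup>2 / 4 = 2 * l" "orth_proj Vp (v - v0) = 0" "z - z0 + (1/2) *\<^sub>R br v v0 = 0"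
      by (auto simp: \<F>_def dr_space_def)
    have "v - v0 \<in> Vm"
      using proj[of "v - v0"] x assms(5) subspace_V by (simp add: subspace_diff)
    then have "v - p0 \<in> Vm"
      using subspace_add[OF Vm(1) _ m0(1), of "v - v0"] by (simp add: v0 algebra_simps)
    moreover from this have "br v v0 = br (v - p0) m0"
      using br_v0[of "v - p0"] by simp
    moreover have eq: "v - v0 = v - p0 - m0" by (simp add: v0)
    \<comment> \<open>Since \<open>br p0\<close> vanishes on \<open>Vm\<close> and the third
      coordinate of the translating element is 1, the translation only adds \<open>p0\<close>, and
      subtracting \<open>p0\<close> gives the preimage.\<close>
    ultimately have "(v - p0, z, t) \<in> \<F>m" "x = dr_mult Z J (p0, 0, 1) (v - p0, z, t)"
      using x(1-4,7) x(5)[unfolded eq] by (simp_all add: \<F>m_def dr_space_def br_pm)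
    then show "x \<in> dr_mult Z J (p0, 0, 1) ` \<F>m" by blast
  next
    fix x assume "x \<in> dr_mult Z J (p0, 0, 1) ` \<F>m"
    then obtain m z t where x: "x = (p0 + m, z, t)" "m \<in> Vm" "z \<in> Z" "t > 0"
      "t + (norm (m - m0))\<^sup>2 / 4 = 2 * l" "z - z0 + (1/2) *\<^sub>R br m m0 = 0"
      by (auto simp: \<F>m_def dr_space_def br_pm)
    have eq: "p0 + m - v0 = m - m0" by (simp add: v0)
    have "m - m0 \<in> Vm" using x m0 Vm(1) by (simp add: subspace_diff)
    then have "orth_proj Vp (m - m0) = 0" using proj Vm(2) by blast
    then show "x \<in> \<F>"
      using x p0 Vm(2) subspace_V unfolding x(1) \<F>_def
      by (auto simp: dr_space_def eq br_v0 intro!: subspace_add)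
  qed
  moreover have "focal_varieties (dr_space V Z) (dr_F_decomp Z J Vp Vm v0 z0 l) = {\<F>}"
    unfolding \<F>_def by (rule focal_varieties_dr_F_decomp[OF Vp(1,2) Vm(1) assms(4-7)])
  moreover have "focal_varieties (dr_space Vm Z)
      (dr_F_point Z (J_restrict J Vm) (m0, z0, - 2 * l)) = {\<F>m}"
    unfolding \<F>m_def
    \<comment> \<open>The result for the point function is used on the Damek-Ricci structure of
      \<open>Vm\<close>, whose bracket is that of the restricted \<open>J\<close>.\<close>
    by (rule damek_ricci.focal_varieties_dr_F_point[OF damek_ricci_submodule[OF assms(3)] m0(1) assms(6,7)])
  ultimately show ?thesis
    unfolding p0_def m0_def
    using closed_lie_subgroup_dr[OF assms(3)] damek_ricci_submodule[OF assms(3)]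
      hom_dr[OF assms(3)] isometric_embedding_dr[OF assms(3)] by blast
qed

end
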